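(* Let $\alpha,\beta>-1$, $n\in\mathbb N$, and let $D^n_i(x;\alpha,\beta)$ be the dual Bernstein polynomials of degree $n$. Dual Bernstein polynomials satisfy the fourth-order recurrence relation (with respect to $i$) of the form $$\mathcal Q_4D^n_i(x;\alpha,\beta)\equiv\mathcal N^{(\alpha,\beta,n)}_i\,\mathcal M^{(\alpha,\beta,n)}_i\,D^n_i(x;\alpha,\beta)=0\qquad(0\le i\le n),$$ where $$\mathcal M^{(\alpha,\beta,n)}_i:=(i)_2(n-i+\alpha+1)(x-1)\mathcal E^{-1}-(n-i)_2(i+\beta+1)x\,\mathcal E+(i+1)(n-i+1)\big[(i+\beta+1)(1-x)+(n-i+\alpha+1)x\big]\mathcal I,$$ $$\mathcal N^{(\alpha,\beta,n)}_i:=\mathcal E^{-1}(\mathcal E-\mathcal I)^2\big(A^{(\alpha,\beta)}_{ni}\big)^{-1}\mathcal I .$$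
   Context: Shift operators: $\mathcal E^m$ is the $m$th shift operator acting on the variable $i$ by $\mathcal E^m z_i:=z_{i+m}$ for $m\in\mathbb Z$; $\mathcal I:=\mathcal E^0$ and $\mathcal E:=\mathcal E^1$. The operator $\mathcal Q_4$ is the composition of the two second-order difference operators $\mathcal N^{(\alpha,\beta,n)}_i$ and $\mathcal M^{(\alpha,\beta,n)}_i$. Pochhammer symbol: $(c)_0:=1$, $(c)_l:=c(c+1)\cdots(c+l-1)$ for $l\ge1$. Inner product: $\langle f,g\rangle_{\alpha,\beta}:=\int_0^1(1-x)^\alpha x^\beta f(x)g(x)\,\mathrm dx$. Bernstein basis polynomials: $B^n_i(x):=\binom{n}{i}x^i(1-x)^{n-i}$, $i=0,1,\ldots,n$; they form a basis of the space $\Pi_n$ of polynomials of degree at most $n$. Dual Bernstein polynomials of degree $n$: the polynomials $D^n_0(x;\alpha,\beta),\ldots,D^n_n(x;\alpha,\beta)\in\Pi_n$ defined by $\langle B^n_i,D^n_j(\cdot;\alpha,\beta)\rangle_{\alpha,\beta}=\delta_{ij}$ for $i,j=0,1,\ldots,n$, where $\delta_{ij}$ is the Kronecker delta. Convention: $D^n_i(x;\alpha,\beta):=0$ for $i<0$ or $i>n$. Constants: $\sigma:=\alpha+\beta+1$, $K:=\Gamma(\alpha+1)\Gamma(\beta+1)/\Gamma(\sigma+1)$, and $$A^{(\alpha,\beta)}_{ni}:=\frac{(-1)^{n-i}(n+1)(\sigma+1)_n}{K\,(\alpha+1)_{n-i}(\beta+1)_i}.$$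
   Formalization: The Pochhammer symbol of index -1, needed at i=0 and i=n, is read as (c+1)_{-1}=1/c; where this is 1/0 (β=0, i=0 or α=0, i=n), Q_4 is the composition with the removable singularity cancelled, as a limit of its coefficients in α, β. Elsewhere Q_4 is literally the composition NM. *)

theory Defs
  imports "HOL-Analysis.Analysis" "HOL-Computational_Algebra.Polynomial"
begin

definition jacobi_inner :: "real \<Rightarrow> real \<Rightarrow> (real \<Rightarrow> real) \<Rightarrow> (real \<Rightarrow> real) \<Rightarrow> real" where
  "jacobi_inner \<alpha> \<beta> f g =
     integral {0..1} (\<lambda>x. (1 - x) powr \<alpha> * x powr \<beta> * f x * g x)"

text \<open>
  A family indexed by all integers, so that the convention that the polynomials
  vanish outside the range from 0 to \<open>n\<close> is part of the definition. For
  \<open>\<alpha>, \<beta> > -1\<close> there is exactly one such family.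
\<close>

definition dual_bernstein :: "real \<Rightarrow> real \<Rightarrow> nat \<Rightarrow> (int \<Rightarrow> real poly) \<Rightarrow> bool" where
  "dual_bernstein \<alpha> \<beta> n D \<longleftrightarrow>
     (\<forall>j. degree (D j) \<le> n) \<and>
     (\<forall>i\<le>n. \<forall>j\<le>n. jacobi_inner \<alpha> \<beta> (Bernstein n i) (poly (D (int j))) = (if i = j then 1 else 0)) \<and>
     (\<forall>j. j < 0 \<or> int n < j \<longrightarrow> D j = 0)"

text \<open>
  At the ends of the range the recurrence involves the Pochhammer symbol with index
  \<open>-1\<close>. It is read as usual, \<open>(c)\<^sub>l = \<Gamma>(c + l) / \<Gamma>(c)\<close>, so \<open>(c)\<^sub>-\<^sub>l = 1 / (c - l)\<^sub>l\<close> and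
  \<open>(c + 1)\<^sub>-\<^sub>1 = 1 / c\<close>.
\<close>

definition poch :: "real \<Rightarrow> int \<Rightarrow> real" where
  "poch c l = (if 0 \<le> l then pochhammer c (nat l)
               else inverse (pochhammer (c + of_int l) (nat (- l))))"

definition K_const :: "real \<Rightarrow> real \<Rightarrow> real" where
  "K_const \<alpha> \<beta> = (let \<sigma> = \<alpha> + \<beta> + 1 in Gamma (\<alpha> + 1) * Gamma (\<beta> + 1) / Gamma (\<sigma> + 1))"

definition A_coeff :: "real \<Rightarrow> real \<Rightarrow> nat \<Rightarrow> int \<Rightarrow> real" where
  "A_coeff \<alpha> \<beta> n i =
     (let \<sigma> = \<alpha> + \<beta> + 1 in
      (-1) powi (int n - i) * (real n + 1) * poch (\<sigma> + 1) (int n)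
        / (K_const \<alpha> \<beta> * poch (\<alpha> + 1) (int n - i) * poch (\<beta> + 1) i))"

definition shift :: "int \<Rightarrow> (int \<Rightarrow> real) \<Rightarrow> int \<Rightarrow> real" where
  "shift m z = (\<lambda>i. z (i + m))"

definition fwd_diff :: "(int \<Rightarrow> real) \<Rightarrow> int \<Rightarrow> real" where
  "fwd_diff z = (\<lambda>i. shift 1 z i - shift 0 z i)"

definition M_op :: "real \<Rightarrow> real \<Rightarrow> nat \<Rightarrow> real \<Rightarrow> (int \<Rightarrow> real) \<Rightarrow> int \<Rightarrow> real" where
  "M_op \<alpha> \<beta> n x z = (\<lambda>i. let r = real_of_int i; s = real_of_int (int n - i) in
       poch r 2 * (s + \<alpha> + 1) * (x - 1) * shift (-1) z i
     - poch s 2 * (r + \<beta> + 1) * x * shift 1 z i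
     + (r + 1) * (s + 1) * ((r + \<beta> + 1) * (1 - x) + (s + \<alpha> + 1) * x) * shift 0 z i)"

definition N_op :: "real \<Rightarrow> real \<Rightarrow> nat \<Rightarrow> (int \<Rightarrow> real) \<Rightarrow> int \<Rightarrow> real" where
  "N_op \<alpha> \<beta> n z =
     shift (-1) ((fwd_diff ^^ 2) (\<lambda>i. inverse (A_coeff \<alpha> \<beta> n i) * shift 0 z i))"

text \<open>
  The operator \<open>Q\<^sub>4\<close> is the composition of \<open>N\<close> and \<open>M\<close>, as a difference operator. For
  \<open>\<beta> = 0\<close>, \<open>i = 0\<close> the coefficient of \<open>z\<^sub>0\<close> contributed by \<open>(M z)\<^sub>-\<^sub>1\<close> contains the product
  \<open>(i + \<beta> + 1) (\<beta> + 1)\<^sub>i\<close> at \<open>i = -1\<close>, i.e. \<open>\<beta> * (1 / \<beta>)\<close>, and symmetrically in \<open>\<alpha>\<close> for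
  \<open>i = n\<close>. These singularities of the coefficients in the parameters are removable and the
  coefficients are meant in the simplified form; this is expressed by the limit, in which
  the sequence \<open>z\<close> is kept fixed. Wherever the coefficients of the composition are all
  defined, the limit is just the value of the composition.
\<close>

definition Q4_op :: "real \<Rightarrow> real \<Rightarrow> nat \<Rightarrow> real \<Rightarrow> (int \<Rightarrow> real) \<Rightarrow> int \<Rightarrow> real" where
  "Q4_op \<alpha> \<beta> n x z i =
     Lim (at (\<alpha>, \<beta>) within {(a, b). a \<noteq> 0 \<and> b \<noteq> 0}) (\<lambda>(a, b). N_op a b n (M_op a b n x z) i)"

end

theory Submission
  imports Defs
begin

text \<open>
  Put \<open>w\<^sub>i = A\<^sub>n\<^sub>i\<^sup>-\<^sup>1 M\<^sub>i D\<^sub>i\<close>, a polynomial in \<open>x\<close> of degree at most \<open>n + 1\<close>. Multiplying the Bernstein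
  basis of degree \<open>n - 1\<close> by \<open>x\<close> and \<open>1 - x\<close> gives multiples of that of degree \<open>n\<close>, so duality shows
  that \<open>w\<^sub>i\<close> is orthogonal to all polynomials of degree less than \<open>n\<close>. The values \<open>D\<^sub>i(0)\<close> and
  \<open>D\<^sub>i(1)\<close> are explicit quotients of Pochhammer symbols, which makes \<open>w\<^sub>i(0)\<close> and \<open>w\<^sub>i(1)\<close> affine in \<open>i\<close>.
  Hence the second difference of \<open>w\<close> has degree at most \<open>n + 1\<close>, is orthogonal to all polynomials
  of degree less than \<open>n\<close> and vanishes at 0 and 1, which forces it to be zero.
\<close>

subsection \<open>The Jacobi weight\<close>

text \<open>A functional of a single polynomial, so that pairings can be handled by identities in
  the polynomial ring; \<open>jacobi_inner_Bernstein\<close> links it to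
  \<open>jacobi_inner\<close>.\<close>

definition jacobi_integral :: "real \<Rightarrow> real \<Rightarrow> real poly \<Rightarrow> real" where
  "jacobi_integral \<alpha> \<beta> p = integral {0..1} (\<lambda>x. (1 - x) powr \<alpha> * x powr \<beta> * poly p x)"

lemma powr_mult_power: "x powr a * x ^ k = x powr (a + real k)" if "0 \<le> x" for x a :: real
  using that by (cases "x = 0"; cases "k = 0") (auto simp: powr_add powr_realpow)

lemma has_integral_jacobi_bernstein:
  assumes "\<alpha> > -1" "\<beta> > -1"
  shows "((\<lambda>x. (1 - x) powr \<alpha> * x powr \<beta> * (x ^ k * (1 - x) ^ l))
           has_integral Beta (\<beta> + real k + 1) (\<alpha> + real l + 1)) {0..1}"
proof -
  have "((\<lambda>x. x powr (\<beta> + real k) * (1 - x) powr (\<alpha> + real l))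
           has_integral Beta (\<beta> + real k + 1) (\<alpha> + real l + 1)) {0..1}"
    using has_integral_Beta_real[of "\<beta> + real k + 1" "\<alpha> + real l + 1"] assms by simp
  then show ?thesis
  proof (rule has_integral_eq[rotated])
    fix x :: real assume "x \<in> {0..1}"
    then have "x powr (\<beta> + real k) = x powr \<beta> * x ^ k"
      and "(1 - x) powr (\<alpha> + real l) = (1 - x) powr \<alpha> * (1 - x) ^ l"
      using powr_mult_power[of x \<beta> k] powr_mult_power[of "1 - x" \<alpha> l] by auto
    then show "x powr (\<beta> + real k) * (1 - x) powr (\<alpha> + real l) =
        (1 - x) powr \<alpha> * x powr \<beta> * (x ^ k * (1 - x) ^ l)" by simp
  qed
qed

text \<open>For negative exponents the weight is unbounded, so continuity is no argument; expanding
  \<open>p\<close> in monomials leaves Beta integrals.\<close>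

lemma integrable_jacobi_poly:
  fixes p :: "real poly"
  assumes "\<alpha> > -1" "\<beta> > -1"
  shows "(\<lambda>x. (1 - x) powr \<alpha> * x powr \<beta> * poly p x) integrable_on {0..1}"
proof -
  have "(\<lambda>x. \<Sum>i\<le>degree p. coeff p i * ((1 - x) powr \<alpha> * x powr \<beta> * (x ^ i * (1 - x) ^ 0)))
          integrable_on {0..1}"
  proof (rule integrable_sum)
    fix i
    show "(\<lambda>x. coeff p i * ((1 - x) powr \<alpha> * x powr \<beta> * (x ^ i * (1 - x) ^ 0))) integrable_on {0..1}"
      by (rule has_integral_integrable[OF has_integral_mult_right[OF has_integral_jacobi_bernstein[OF assms]]])
  qed simp
  then show ?thesis
    by (simp add: poly_altdef sum_distrib_left mult_ac)
qed

lemma jacobi_integral_add: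
  assumes "\<alpha> > -1" "\<beta> > -1"
  shows "jacobi_integral \<alpha> \<beta> (p + q) = jacobi_integral \<alpha> \<beta> p + jacobi_integral \<alpha> \<beta> q"
  using integral_add[OF integrable_jacobi_poly[OF assms, of p] integrable_jacobi_poly[OF assms, of q]]
  by (simp add: jacobi_integral_def ring_distribs)

lemma jacobi_integral_smult: "jacobi_integral \<alpha> \<beta> (smult c p) = c * jacobi_integral \<alpha> \<beta> p"
  unfolding jacobi_integral_def by (subst integral_mult_right[symmetric]) (simp add: mult_ac)

lemma jacobi_integral_0: "jacobi_integral \<alpha> \<beta> 0 = 0"
  using jacobi_integral_smult[of \<alpha> \<beta> 0 0] by simp

lemma jacobi_integral_diff:
  assumes "\<alpha> > -1" "\<beta> > -1"
  shows "jacobi_integral \<alpha> \<beta> (p - q) = jacobi_integral \<alpha> \<beta> p - jacobi_integral \<alpha> \<beta> q"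
  using jacobi_integral_add[OF assms, of "p - q" q] by simp

lemma jacobi_integral_sum:
  assumes "\<alpha> > -1" "\<beta> > -1"
  shows "jacobi_integral \<alpha> \<beta> (\<Sum>i\<in>A. f i) = (\<Sum>i\<in>A. jacobi_integral \<alpha> \<beta> (f i))"
  by (induction A rule: infinite_finite_induct)
     (simp_all add: jacobi_integral_add assms jacobi_integral_0)

lemma jacobi_integral_bernstein:
  assumes "\<alpha> > -1" "\<beta> > -1"
  shows "jacobi_integral \<alpha> \<beta> ([:0, 1:] ^ k * [:1, -1:] ^ l) = Beta (\<beta> + real k + 1) (\<alpha> + real l + 1)"
  using integral_unique[OF has_integral_jacobi_bernstein[OF assms, of k l]]
  by (simp add: jacobi_integral_def poly_power)

lemma jacobi_integral_pos_definite:
  assumes ab: "\<alpha> > -1" "\<beta> > -1"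
    and "jacobi_integral \<alpha> \<beta> ([:0, 1:] * [:1, -1:] * r * r) = 0"
  shows "r = 0"
proof -
  define f where "f x = (1 - x) powr \<alpha> * x powr \<beta> * poly ([:0, 1:] * [:1, -1:] * r * r) x" for x :: real
  have nonneg: "0 \<le> f x" if "x \<in> {0..1}" for x
  proof -
    have "f x = (1 - x) powr \<alpha> * x powr \<beta> * (x * (1 - x) * (poly r x)\<^sup>2)"
      by (simp add: f_def power2_eq_square algebra_simps)
    then show ?thesis using that by simp
  qed
  have int: "f integrable_on {0..1}"
    unfolding f_def by (rule integrable_jacobi_poly[OF ab])
  \<comment> \<open>The weight may be discontinuous at 0 and 1. On an interior interval
    \<open>f\<close> is continuous and nonnegative with integral zero, so it vanishes there, and
    with it \<open>r\<close>.\<close>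
  have sub: "{1/4..3/4} \<subseteq> {0..1::real}" by auto
  have int': "f integrable_on {1/4..3/4}"
    by (rule integrable_on_subinterval[OF int]) auto
  have "integral {1/4..3/4} f \<le> integral {0..1} f"
    by (rule integral_subset_le[OF sub int' int]) (use nonneg in auto)
  also have "\<dots> = 0"
    using assms(3) unfolding jacobi_integral_def f_def .
  finally have "integral {1/4..3/4} f = 0"
    using integral_nonneg[OF int'] nonneg sub by (force intro: antisym)
  then have zero: "(f has_integral 0) (cbox (1/4) (3/4))"
    using int' by (simp add: has_integral_iff)
  have cont: "continuous_on (cbox (1/4) (3/4)) f"
    unfolding f_def by (intro continuous_intros) auto
  have "poly r x = 0" if "x \<in> {1/4..3/4}" for x
  proof -
    have "f x = 0"
      by (rule has_integral_0_cbox_imp_0[OF cont _ zero]) (use that nonneg in auto)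
    then show ?thesis using that by (auto simp: f_def)
  qed
  then have "{1/4..3/4} \<subseteq> {x. poly r x = 0}" by auto
  moreover have "infinite {1/4..3/4::real}" by (simp add: infinite_Icc)
  ultimately have "infinite {x. poly r x = 0}" by (rule infinite_super)
  then show ?thesis using poly_roots_finite by blast
qed

section \<open>Orthogonality to polynomials of low degree\<close>

lemma orthogonal_bernstein_imp_orthogonal:
  assumes ab: "\<alpha> > -1" "\<beta> > -1"
    and orth: "\<And>j. j \<le> m \<Longrightarrow> jacobi_integral \<alpha> \<beta> (p * ([:0, 1:] ^ j * [:1, -1:] ^ (m - j))) = 0"
    and "degree r \<le> m"
  shows "jacobi_integral \<alpha> \<beta> (p * r) = 0"
proof -
  \<comment> \<open>Here \<open>d\<close> is the missing degree. Since x + (1 - x) = 1, a product of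
    degree \<open>k + l\<close> is a sum of two products of degree \<open>k + l + 1\<close>, so
    orthogonality descends from degree \<open>m\<close>; \<open>l = 0\<close> then gives the
    monomials.\<close>
  have step: "jacobi_integral \<alpha> \<beta> (p * ([:0, 1:] ^ k * [:1, -1:] ^ l)) = 0" if "k + l + d = m" for k l d
    using that
  proof (induction d arbitrary: k l)
    case 0
    then show ?case using orth[of k] by (metis add.right_neutral diff_add_inverse le_add1)
  next
    case (Suc d)
    have one: "[:0, 1:] + [:1, -1:] = (1 :: real poly)" by (simp add: one_pCons)
    have "p * ([:0, 1:] ^ k * [:1, -1:] ^ l) =
        p * ([:0, 1:] ^ k * [:1, -1:] ^ l) * ([:0, 1:] + [:1, -1:])"
      unfolding one by simp
    also have "\<dots> = p * ([:0, 1:] ^ Suc k * [:1, -1:] ^ l) + p * ([:0, 1:] ^ k * [:1, -1:] ^ Suc l)"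
      by (simp only: power_Suc algebra_simps)
    finally show ?case
      using Suc.IH[of "Suc k" l] Suc.IH[of k "Suc l"] Suc.prems
      by (simp only: jacobi_integral_add[OF ab])
  qed
  have "p * r = (\<Sum>i\<le>degree r. smult (coeff r i) (p * ([:0, 1:] ^ i * [:1, -1:] ^ 0)))"
    by (subst poly_as_sum_of_monoms[of r, symmetric])
       (simp add: sum_distrib_left monom_altdef)
  also have "jacobi_integral \<alpha> \<beta> \<dots> = 0"
    using step[of _ 0] \<open>degree r \<le> m\<close>
    by (simp only: jacobi_integral_sum[OF ab] jacobi_integral_smult)
       (auto intro!: sum.neutral simp: le_iff_add)
  finally show ?thesis .
qed

text \<open>
  A polynomial vanishing at both endpoints is \<open>x (1 - x) r\<close>, and \<open>x (1 - x)\<close> is positive.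
\<close>
lemma orthogonal_vanishing_endpoints_eq_0:
  assumes ab: "\<alpha> > -1" "\<beta> > -1"
    and deg: "degree q \<le> n + 1" and "poly q 0 = 0" "poly q 1 = 0"
    and orth: "\<And>r. degree r < n \<Longrightarrow> jacobi_integral \<alpha> \<beta> (q * r) = 0"
  shows "q = 0"
proof (rule ccontr)
  assume "q \<noteq> 0"
  obtain s where s: "q = [:0, 1:] * s"
    using \<open>poly q 0 = 0\<close> by (metis dvdE minus_zero poly_eq_0_iff_dvd)
  have "poly s 1 = 0" using \<open>poly q 1 = 0\<close> s by simp
  \<comment> \<open>The root criterion yields the factor x - 1, the negative of the 1 - x used
    throughout.\<close>
  then have "- [:1, -1:] dvd s"
    by (simp add: poly_eq_0_iff_dvd)
  then obtain r where r: "s = [:1, -1:] * r"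
    unfolding minus_dvd_iff by (rule dvdE)
  have "r \<noteq> 0" using \<open>q \<noteq> 0\<close> s r by auto
  then have "degree q = degree r + 2"
    unfolding s r by (simp add: degree_mult_eq del: mult_pCons_left)
  then have "jacobi_integral \<alpha> \<beta> (q * r) = 0" using deg by (intro orth) simp
  then show False
    using jacobi_integral_pos_definite[OF ab, of r] \<open>r \<noteq> 0\<close> by (simp add: s r mult.assoc)
qed

subsection \<open>Dual Bernstein polynomials at the endpoints\<close>

text \<open>Pascal's rule, in the form that trades one order of the alternating sum for one
  difference of \<open>f\<close>.\<close>

lemma alternating_sum_binomial_Suc:
  "(\<Sum>i\<le>Suc n. (-1) ^ i * real (Suc n choose i) * f i) =
   (\<Sum>i\<le>n. (-1) ^ i * real (n choose i) * (f i - f (Suc i)))"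
proof -
  have "(\<Sum>i\<le>Suc n. (-1) ^ i * real (Suc n choose i) * f i) =
      f 0 + (\<Sum>i\<le>n. (-1) ^ Suc i * real (Suc n choose Suc i) * f (Suc i))"
    by (subst sum.atMost_Suc_shift) simp
  also have "\<dots> = f 0 + (\<Sum>i\<le>n. (-1) ^ Suc i * real (n choose Suc i) * f (Suc i))
      - (\<Sum>i\<le>n. (-1) ^ i * real (n choose i) * f (Suc i))"
    by (simp add: algebra_simps sum.distrib sum_subtractf sum_negf)
  also have "f 0 + (\<Sum>i\<le>n. (-1) ^ Suc i * real (n choose Suc i) * f (Suc i)) =
      (\<Sum>i\<le>Suc n. (-1) ^ i * real (n choose i) * f i)"
    by (subst sum.atMost_Suc_shift) simp
  also have "\<dots> = (\<Sum>i\<le>n. (-1) ^ i * real (n choose i) * f i)" by simp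
  finally show ?thesis by (simp add: algebra_simps sum_subtractf)
qed

text \<open>The two products share \<open>pochhammer (c + 1) j\<close>; only the outer factors
  \<open>c\<close> and \<open>c + 1 + j\<close> differ.\<close>

lemma pochhammer_diff:
  "pochhammer c (Suc j) - pochhammer (c + 1) (Suc j) = - (real j + 1) * pochhammer (c + 1) j"
  for c :: real
  unfolding pochhammer_rec[of c] pochhammer_Suc[of "c + 1"] by (simp add: algebra_simps)

text \<open>Up to sign this is an \<open>n\<close>-th difference of a polynomial of degree
  \<open>j < n\<close> in \<open>i\<close>. Each induction step lowers both \<open>n\<close> and
  \<open>j\<close>, until a constant is differenced.\<close>

lemma alternating_sum_binomial_pochhammer:
  "j < n \<Longrightarrow> (\<Sum>i\<le>n. (-1) ^ i * real (n choose i) * pochhammer (c + real i) j) = 0"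
proof (induction n arbitrary: j c)
  case (Suc n)
  show ?case
  proof (cases j)
    case 0
    then show ?thesis by (simp only: alternating_sum_binomial_Suc) simp
  next
    case (Suc k)
    have "(\<Sum>i\<le>Suc n. (-1) ^ i * real (Suc n choose i) * pochhammer (c + real i) j) =
        (\<Sum>i\<le>n. (-1) ^ i * real (n choose i) * (- (real k + 1) * pochhammer (c + 1 + real i) k))"
      unfolding alternating_sum_binomial_Suc Suc
    proof (rule sum.cong[OF refl])
      fix i
      show "(-1) ^ i * real (n choose i) *
            (pochhammer (c + real i) (Suc k) - pochhammer (c + real (Suc i)) (Suc k)) =
          (-1) ^ i * real (n choose i) * (- (real k + 1) * pochhammer (c + 1 + real i) k)"
        using pochhammer_diff[of "c + real i" k] by (simp add: add_ac)
    qed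
    also have "\<dots> = - (real k + 1) *
        (\<Sum>i\<le>n. (-1) ^ i * real (n choose i) * pochhammer (c + 1 + real i) k)"
      by (simp only: sum_distrib_left mult_ac)
    also have "\<dots> = 0" using Suc.IH[of k "c + 1"] Suc.prems Suc by simp
    finally show ?thesis .
  qed
qed simp

lemma Gamma_plus_nat: "Gamma (c + real k) = Gamma c * pochhammer c k" if "c > 0" for c :: real
proof -
  have "c \<notin> \<int>\<^sub>\<le>\<^sub>0" using that by (auto elim!: nonpos_Ints_cases)
  then show ?thesis using pochhammer_Gamma[of c k] Gamma_real_pos[OF that] by simp
qed

section \<open>Duality as pairings, and the reflection x to 1 - x\<close>

lemma jacobi_inner_Bernstein:
  "jacobi_inner \<alpha> \<beta> (Bernstein n k) (poly p) =
     real (n choose k) * jacobi_integral \<alpha> \<beta> ([:0, 1:] ^ k * [:1, -1:] ^ (n - k) * p)"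
  unfolding jacobi_integral_smult[symmetric]
  unfolding jacobi_inner_def jacobi_integral_def Bernstein_def
  by (rule arg_cong[where f = "integral _"]) (simp add: fun_eq_iff poly_power algebra_simps)

text \<open>Outside the range the convention \<open>D i = 0\<close> agrees with the right-hand side,
  so later arguments may shift the integer \<open>i\<close> freely.\<close>

lemma dual_bernstein_pairing:
  assumes "dual_bernstein \<alpha> \<beta> n D" and "k \<le> n"
  shows "jacobi_integral \<alpha> \<beta> ([:0, 1:] ^ k * [:1, -1:] ^ (n - k) * D i) =
           (if i = int k then 1 / real (n choose k) else 0)"
proof (cases "0 \<le> i \<and> i \<le> int n")
  case True
  then obtain j where j: "i = int j" "j \<le> n" using nonneg_int_cases by fastforce
  have "jacobi_inner \<alpha> \<beta> (Bernstein n k) (poly (D (int j))) = (if k = j then 1 else 0)"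
    using assms j unfolding dual_bernstein_def by blast
  moreover have "real (n choose k) \<noteq> 0" using \<open>k \<le> n\<close> by simp
  ultimately show ?thesis
    unfolding j(1) jacobi_inner_Bernstein by (auto simp: field_simps split: if_splits)
next
  case False
  then have "D i = 0" and "i \<noteq> int k" using assms by (auto simp: dual_bernstein_def)
  then show ?thesis by (simp add: jacobi_integral_0)
qed

lemma jacobi_integral_reflect:
  "jacobi_integral \<beta> \<alpha> (pcompose p [:1, -1:]) = jacobi_integral \<alpha> \<beta> p"
proof -
  define f where "f x = (1 - x) powr \<alpha> * x powr \<beta> * poly p x" for x :: real
  have *: "((\<lambda>x. g (1 - x)) has_integral c) {0..1}" if "(g has_integral c) {0..1}"
    for g :: "real \<Rightarrow> real" and c
  proof -
    have "(\<lambda>x. 1 - x) ` {0..1::real} = {0..1}"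
      by (auto simp: image_iff intro!: bexI[of _ "1 - x" for x])
    then show ?thesis
      using has_integral_affinity[of g c 0 1 "-1" 1] that by simp
  qed
  have "integral {0..1} (\<lambda>x. f (1 - x)) = integral {0..1} f"
  proof (cases "f integrable_on {0..1}")
    case True
    then show ?thesis using * by (blast intro: integral_unique)
  next
    \<comment> \<open>A non-integrable function has integral 0 by default. Reflection is an
      involution, so both functions are non-integrable here.\<close>
    case False
    then have "\<not> (\<lambda>x. f (1 - x)) integrable_on {0..1}"
      using *[of "\<lambda>x. f (1 - x)"] by (auto simp: integrable_on_def)
    with False show ?thesis by (simp add: not_integrable_integral)
  qed
  then show ?thesis
    unfolding jacobi_integral_def f_def[abs_def] by (simp add: poly_pcompose mult_ac)
qed

text \<open>Reflection reverses the Bernstein basis and swaps the parameters. It transfers the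
  evaluation at 0 to one at 1.\<close>

lemma dual_bernstein_reflect:
  assumes "dual_bernstein \<alpha> \<beta> n D"
  shows "dual_bernstein \<beta> \<alpha> n (\<lambda>i. pcompose (D (int n - i)) [:1, -1:])"
  unfolding dual_bernstein_def
proof (intro conjI allI impI)
  fix j show "degree (pcompose (D (int n - j)) [:1, -1:]) \<le> n"
    using assms by (simp add: dual_bernstein_def degree_pcompose)
next
  fix j assume "j < 0 \<or> int n < j"
  then show "pcompose (D (int n - j)) [:1, -1:] = 0"
    using assms by (auto simp: dual_bernstein_def)
next
  fix i j assume ij: "i \<le> n" "j \<le> n"
  have "[:0, 1:] ^ i * [:1, -1:] ^ (n - i) * pcompose (D (int n - int j)) [:1, -1:] =
      pcompose ([:0, 1:] ^ (n - i) * [:1, -1:] ^ (n - (n - i)) * D (int n - int j)) [:1, -1:]"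
    using ij by (intro poly_eq_poly_eq_iff[THEN iffD1] ext) (simp add: poly_pcompose poly_power mult_ac)
  then show "jacobi_inner \<beta> \<alpha> (Bernstein n i) (poly (pcompose (D (int n - int j)) [:1, -1:])) =
      (if i = j then 1 else 0)"
    unfolding jacobi_inner_Bernstein
    using ij dual_bernstein_pairing[OF assms, of "n - i" "int n - int j"]
    by (auto simp: jacobi_integral_reflect binomial_symmetric[of i n] simp del: pcompose_mult)
qed

text \<open>
  The values \<open>D\<^sub>i(0)\<close> are the Bernstein coefficients of the kernel reproducing \<open>p(0)\<close>.
  Up to a factor these coefficients are \<open>(-1)\<^sup>i / m i\<close>, because the polynomial with the latter
  coefficients is orthogonal to all multiples of \<open>x\<close> of degree at most \<open>n\<close>.
\<close>
lemma dual_bernstein_at_0: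
  assumes ab: "\<alpha> > -1" "\<beta> > -1" and dual: "dual_bernstein \<alpha> \<beta> n D"
  obtains C where "\<And>i. i \<le> n \<Longrightarrow>
    poly (D (int i)) 0 * pochhammer (\<alpha> + 1) (n - i) * pochhammer (\<beta> + 1) (Suc i) = C * (-1) ^ i"
proof -
  \<comment> \<open>These Pochhammer factors occur in the moment of \<open>b i\<close> against every
    power \<open>Suc j\<close> of x. Dividing by \<open>m i\<close> leaves a polynomial of degree
    \<open>j\<close> in \<open>i\<close>, which the alternating sum annihilates.\<close>
  define m where "m i = pochhammer (\<alpha> + 1) (n - i) * pochhammer (\<beta> + 1) (Suc i)" for i
  have m_pos: "m i > 0" for i
    unfolding m_def using ab by (intro mult_pos_pos pochhammer_pos) auto
  define b :: "nat \<Rightarrow> real poly" where "b i = [:0, 1:] ^ i * [:1, -1:] ^ (n - i)" for i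
  define k where "k = (\<Sum>i\<le>n. smult ((-1) ^ i * real (n choose i) / m i) (b i))"
  have orth_monom: "jacobi_integral \<alpha> \<beta> (k * [:0, 1:] ^ Suc j) = 0" if "j < n" for j
  proof -
    \<comment> \<open>The two Beta arguments have a sum free of \<open>i\<close>, so
      \<open>G\<close> is a common factor of all the moments.\<close>
    define G where "G = Gamma (\<beta> + 1) * Gamma (\<alpha> + 1) / Gamma (\<alpha> + \<beta> + real n + real j + 3)"
    have "jacobi_integral \<alpha> \<beta> (b i * [:0, 1:] ^ Suc j) / m i =
        G * pochhammer (\<beta> + 2 + real i) j" if "i \<le> n" for i
    proof -
      have "b i * [:0, 1:] ^ Suc j = [:0, 1:] ^ (i + Suc j) * [:1, -1:] ^ (n - i)"
        by (simp only: b_def power_add mult_ac)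
      then have "jacobi_integral \<alpha> \<beta> (b i * [:0, 1:] ^ Suc j) =
          Beta (\<beta> + 1 + real (Suc i + j)) (\<alpha> + 1 + real (n - i))"
        by (simp only: jacobi_integral_bernstein[OF ab]) (simp add: add_ac)
      also have "\<dots> = Gamma (\<beta> + 1 + real (Suc i + j)) * Gamma (\<alpha> + 1 + real (n - i)) /
          Gamma (\<alpha> + \<beta> + real n + real j + 3)"
        using that by (simp add: Beta_def of_nat_diff add_ac)
      also have "Gamma (\<beta> + 1 + real (Suc i + j)) =
          Gamma (\<beta> + 1) * (pochhammer (\<beta> + 1) (Suc i) * pochhammer (\<beta> + 2 + real i) j)"
        using Gamma_plus_nat[of "\<beta> + 1" "Suc i + j"] pochhammer_product'[of "\<beta> + 1" "Suc i" j] ab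
        by (simp add: add_ac)
      also have "Gamma (\<alpha> + 1 + real (n - i)) = Gamma (\<alpha> + 1) * pochhammer (\<alpha> + 1) (n - i)"
        using Gamma_plus_nat ab by simp
      finally have "jacobi_integral \<alpha> \<beta> (b i * [:0, 1:] ^ Suc j) =
          G * pochhammer (\<beta> + 2 + real i) j * m i"
        by (simp only: m_def G_def) (simp add: mult_ac)
      then show ?thesis
        using m_pos[of i] by simp
    qed
    note 1 = this
    have "k * [:0, 1:] ^ Suc j =
        (\<Sum>i\<le>n. smult ((-1) ^ i * real (n choose i) / m i) (b i * [:0, 1:] ^ Suc j))"
      by (simp only: k_def sum_distrib_right mult_smult_left)
    also have "jacobi_integral \<alpha> \<beta> \<dots> = (\<Sum>i\<le>n. (-1) ^ i * real (n choose i) *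
        (jacobi_integral \<alpha> \<beta> (b i * [:0, 1:] ^ Suc j) / m i))"
      by (simp only: jacobi_integral_sum[OF ab] jacobi_integral_smult) (simp add: field_simps)
    also have "\<dots> = G * (\<Sum>i\<le>n. (-1) ^ i * real (n choose i) * pochhammer (\<beta> + 2 + real i) j)"
      unfolding sum_distrib_left by (intro sum.cong refl) (simp only: 1 atMost_iff mult_ac)
    also have "\<dots> = 0"
      using alternating_sum_binomial_pochhammer[OF that] by simp
    finally show ?thesis .
  qed
  have reproducing: "jacobi_integral \<alpha> \<beta> (k * p) = poly p 0 * jacobi_integral \<alpha> \<beta> k"
    if "degree p \<le> n" for p
  proof -
    have "k * p = (\<Sum>i\<le>n. smult (coeff p i) (k * [:0, 1:] ^ i))"
      by (subst poly_as_sum_of_monoms'[OF that, symmetric])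
         (simp add: sum_distrib_left monom_altdef)
    also have "jacobi_integral \<alpha> \<beta> \<dots> =
        (\<Sum>i\<le>n. coeff p i * jacobi_integral \<alpha> \<beta> (k * [:0, 1:] ^ i))"
      by (simp only: jacobi_integral_sum[OF ab] jacobi_integral_smult)
    also have "\<dots> = (\<Sum>i\<in>{0}. coeff p i * jacobi_integral \<alpha> \<beta> (k * [:0, 1:] ^ i))"
    proof (rule sum.mono_neutral_right)
      show "\<forall>i\<in>{..n} - {0}. coeff p i * jacobi_integral \<alpha> \<beta> (k * [:0, 1:] ^ i) = 0"
        using orth_monom by (metis DiffE Suc_le_eq atMost_iff insertI1 mult_zero_right not0_implies_Suc)
    qed auto
    finally show ?thesis by (simp add: poly_0_coeff_0)
  qed
  \<comment> \<open>Pairing with the dual basis reads off a Bernstein coefficient of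
    \<open>k\<close>.\<close>
  have pair: "jacobi_integral \<alpha> \<beta> (k * D (int i)) = (-1) ^ i / m i" if "i \<le> n" for i
  proof -
    have "k * D (int i) = (\<Sum>l\<le>n. smult ((-1) ^ l * real (n choose l) / m l) (b l * D (int i)))"
      by (simp only: k_def sum_distrib_right mult_smult_left)
    also have "jacobi_integral \<alpha> \<beta> \<dots> = (\<Sum>l\<le>n. if i = l then (-1) ^ l / m l else 0)"
      unfolding jacobi_integral_sum[OF ab] jacobi_integral_smult
      using dual_bernstein_pairing[OF dual] by (intro sum.cong) (auto simp: b_def)
    finally show ?thesis using that by simp
  qed
  show thesis
  proof (rule that)
    fix i assume "i \<le> n"
    have deg: "degree (D (int i)) \<le> n" using dual by (simp add: dual_bernstein_def)
    have eq: "poly (D (int i)) 0 * jacobi_integral \<alpha> \<beta> k * m i = (-1) ^ i"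
      using reproducing[OF deg] pair[OF \<open>i \<le> n\<close>] m_pos[of i] by (simp add: field_simps)
    \<comment> \<open>The right side of \<open>eq\<close> is a sign, so no factor on the left can
      vanish.\<close>
    then have "jacobi_integral \<alpha> \<beta> k \<noteq> 0"
      by (metis mult_zero_left mult_zero_right power_eq_0_iff neg_equal_0_iff_equal zero_neq_one)
    then show "poly (D (int i)) 0 * pochhammer (\<alpha> + 1) (n - i) * pochhammer (\<beta> + 1) (Suc i) =
        1 / jacobi_integral \<alpha> \<beta> k * (-1) ^ i"
      unfolding eq[symmetric] by (simp add: m_def mult_ac)
  qed
qed

lemma dual_bernstein_at_1:
  assumes ab: "\<alpha> > -1" "\<beta> > -1" and dual: "dual_bernstein \<alpha> \<beta> n D"
  obtains C where "\<And>i. i \<le> n \<Longrightarrow>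
    poly (D (int i)) 1 * pochhammer (\<alpha> + 1) (Suc (n - i)) * pochhammer (\<beta> + 1) i = C * (-1) ^ (n - i)"
proof -
  obtain C where C: "\<And>i. i \<le> n \<Longrightarrow> poly (pcompose (D (int n - int i)) [:1, -1:]) 0 *
      pochhammer (\<beta> + 1) (n - i) * pochhammer (\<alpha> + 1) (Suc i) = C * (-1) ^ i"
    using dual_bernstein_at_0[OF ab(2,1) dual_bernstein_reflect[OF dual]] by blast
  show thesis
  proof (rule that)
    fix i assume "i \<le> n"
    then show "poly (D (int i)) 1 * pochhammer (\<alpha> + 1) (Suc (n - i)) * pochhammer (\<beta> + 1) i = C * (-1) ^ (n - i)"
      using C[of "n - i"] by (simp add: poly_pcompose of_nat_diff mult_ac)
  qed
qed

subsection \<open>The second-order operator applied to the dual basis\<close>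

text \<open>
  The polynomial \<open>A\<^sub>n\<^sub>i\<^sup>-\<^sup>1 M\<^sub>i D\<^sub>i\<close> without the factor depending on \<open>n\<close>, \<open>\<alpha>\<close>, \<open>\<beta>\<close> only. Each linear
  factor of \<open>M\<close> such as \<open>i + \<beta> + 1\<close> is absorbed into a Pochhammer symbol of \<open>A\<^sub>n\<^sub>i\<close>, which removes
  the singularities at \<open>i = -1\<close> and \<open>i = n + 1\<close>; where \<^const>\<open>nat\<close> truncates an index \<open>-1\<close>, the integer
  coefficient in front is zero.
\<close>
definition cleared_M :: "real \<Rightarrow> real \<Rightarrow> nat \<Rightarrow> (int \<Rightarrow> real poly) \<Rightarrow> int \<Rightarrow> real poly" where
  "cleared_M \<alpha> \<beta> n D i =
     (let s = int n - i;
          pa = (\<lambda>l. pochhammer (\<alpha> + 1) (nat l));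
          pb = (\<lambda>l. pochhammer (\<beta> + 1) (nat l))
      in smult ((-1) powi s)
           (smult (of_int ((i + 1) * (s + 1)) * pa s * pb (i + 1)) ([:1, -1:] * D i)
          + smult (of_int ((i + 1) * (s + 1)) * pa (s + 1) * pb i) ([:0, 1:] * D i)
          - smult (of_int (i * (i + 1)) * pa (s + 1) * pb i) ([:1, -1:] * D (i - 1))
          - smult (of_int (s * (s + 1)) * pa s * pb (i + 1)) ([:0, 1:] * D (i + 1))))"

lemma degree_cleared_M:
  assumes "dual_bernstein \<alpha> \<beta> n D"
  shows "degree (cleared_M \<alpha> \<beta> n D i) \<le> n + 1"
proof -
  have deg: "degree ([:a, b:] * D j) \<le> n + 1" for a b j
  proof -
    have "degree ([:a, b:] * D j) \<le> degree [:a, b:] + degree (D j)" by (rule degree_mult_le)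
    also have "\<dots> \<le> 1 + n" using assms by (intro add_mono) (auto simp: dual_bernstein_def)
    finally show ?thesis by simp
  qed
  show ?thesis
    unfolding cleared_M_def Let_def
    by (intro order.trans[OF degree_smult_le] degree_add_le degree_diff_le deg)
qed

text \<open>By absorption both sides equal \<open>n * (n - 1 choose k)\<close>.\<close>

lemma Suc_times_binomial_Suc: "Suc k * (n choose Suc k) = (n - k) * (n choose k)"
  by (metis binomial_absorb_comp binomial_absorption)

text \<open>Multiplication by 1 - x or x turns the test polynomial into \<open>b j\<close> or
  \<open>b (Suc j)\<close>, so only \<open>i = j\<close> and \<open>i = j + 1\<close> can
  contribute. In each case two of the four terms survive, and they cancel by the ratio of
  neighbouring binomial coefficients.\<close>

lemma cleared_M_orthogonal_bernstein:
  assumes ab: "\<alpha> > -1" "\<beta> > -1" and dual: "dual_bernstein \<alpha> \<beta> n D" and "j < n"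
  shows "jacobi_integral \<alpha> \<beta> (cleared_M \<alpha> \<beta> n D i * ([:0, 1:] ^ j * [:1, -1:] ^ (n - 1 - j))) = 0"
proof -
  define b where "b k = [:0, 1 :: real:] ^ k * [:1, -1:] ^ (n - k)" for k
  define c where "c = [:0, 1 :: real:] ^ j * [:1, -1:] ^ (n - 1 - j)"
  have b1: "[:1, -1:] * p * c = b j * p" for p
  proof -
    have "n - j = Suc (n - 1 - j)" using \<open>j < n\<close> by simp
    then show ?thesis by (simp only: b_def c_def power_Suc mult_ac)
  qed
  have b2: "[:0, 1:] * p * c = b (Suc j) * p" for p
    by (simp only: b_def c_def power_Suc mult_ac) simp
  have pair1: "jacobi_integral \<alpha> \<beta> (b j * D k) = (if k = int j then 1 / real (n choose j) else 0)" for k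
    using dual_bernstein_pairing[OF dual, of j k] \<open>j < n\<close> by (simp add: b_def)
  have pair2: "jacobi_integral \<alpha> \<beta> (b (Suc j) * D k) =
      (if k = int j + 1 then 1 / real (n choose Suc j) else 0)" for k
    using dual_bernstein_pairing[OF dual, of "Suc j" k] \<open>j < n\<close> by (simp add: b_def add_ac)
  have pos: "real (n choose j) > 0" "real (n choose Suc j) > 0" using \<open>j < n\<close> by simp_all
  have "real (Suc j) * real (n choose Suc j) = real (n - j) * real (n choose j)"
    using Suc_times_binomial_Suc[of j n] by (metis of_nat_mult)
  then have ratio: "real_of_int (int n - int j) / real (n choose Suc j) = real_of_int (int j + 1) / real (n choose j)"
    using pos \<open>j < n\<close> by (simp add: field_simps of_nat_diff)
  let ?s = "int n - i"
  let ?pa = "\<lambda>l. pochhammer (\<alpha> + 1) (nat l)"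
  let ?pb = "\<lambda>l. pochhammer (\<beta> + 1) (nat l)"
  have "jacobi_integral \<alpha> \<beta> (cleared_M \<alpha> \<beta> n D i * c) =
      (-1) powi ?s *
         (of_int ((i + 1) * (?s + 1)) * ?pa ?s * ?pb (i + 1) * jacobi_integral \<alpha> \<beta> (b j * D i)
        + of_int ((i + 1) * (?s + 1)) * ?pa (?s + 1) * ?pb i * jacobi_integral \<alpha> \<beta> (b (Suc j) * D i)
        - of_int (i * (i + 1)) * ?pa (?s + 1) * ?pb i * jacobi_integral \<alpha> \<beta> (b j * D (i - 1))
        - of_int (?s * (?s + 1)) * ?pa ?s * ?pb (i + 1) * jacobi_integral \<alpha> \<beta> (b (Suc j) * D (i + 1)))"
    unfolding cleared_M_def Let_def
    by (simp only: mult_smult_left distrib_right left_diff_distrib b1 b2 jacobi_integral_smult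
        jacobi_integral_add[OF ab] jacobi_integral_diff[OF ab])
  also have "\<dots> = 0"
  proof -
    consider "i = int j" | "i = int j + 1" | "i \<noteq> int j" "i \<noteq> int j + 1" by blast
    then show ?thesis
    proof cases
      case 1
      have "of_int ((i + 1) * (?s + 1)) * ?pa ?s * ?pb (i + 1) * (1 / real (n choose j)) =
          of_int (?s + 1) * ?pa ?s * ?pb (i + 1) * (real_of_int (int j + 1) / real (n choose j))"
        by (simp add: 1)
      also have "\<dots> = of_int (?s * (?s + 1)) * ?pa ?s * ?pb (i + 1) * (1 / real (n choose Suc j))"
        unfolding ratio[symmetric] by (simp add: 1)
      finally show ?thesis unfolding pair1 pair2 using 1 by simp
    next
      case 2
      have "of_int ((i + 1) * (?s + 1)) * ?pa (?s + 1) * ?pb i * (1 / real (n choose Suc j)) =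
          of_int (i + 1) * ?pa (?s + 1) * ?pb i * (real_of_int (int n - int j) / real (n choose Suc j))"
        by (simp add: 2)
      also have "\<dots> = of_int (i * (i + 1)) * ?pa (?s + 1) * ?pb i * (1 / real (n choose j))"
        unfolding ratio by (simp add: 2)
      finally show ?thesis unfolding pair1 pair2 using 2 by simp
    next
      case 3
      then show ?thesis unfolding pair1 pair2 by simp
    qed
  qed
  finally show ?thesis unfolding c_def .
qed

lemma cleared_M_orthogonal:
  assumes ab: "\<alpha> > -1" "\<beta> > -1" and dual: "dual_bernstein \<alpha> \<beta> n D" and "degree r < n"
  shows "jacobi_integral \<alpha> \<beta> (cleared_M \<alpha> \<beta> n D i * r) = 0"
  by (rule orthogonal_bernstein_imp_orthogonal[OF ab, where m = "n - 1"])
     (use cleared_M_orthogonal_bernstein[OF ab dual] \<open>degree r < n\<close> in auto)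

section \<open>Endpoint values of \<open>cleared_M\<close>\<close>

lemma cleared_M_at_0:
  assumes ab: "\<alpha> > -1" "\<beta> > -1" and dual: "dual_bernstein \<alpha> \<beta> n D"
  obtains C where "\<And>i. -1 \<le> i \<Longrightarrow> i \<le> int n + 1 \<Longrightarrow>
    poly (cleared_M \<alpha> \<beta> n D i) 0 = C * (of_int i + 1)"
proof -
  let ?pa = "\<lambda>l. pochhammer (\<alpha> + 1) (nat l)"
  let ?pb = "\<lambda>l. pochhammer (\<beta> + 1) (nat l)"
  obtain C where C: "\<And>i. i \<le> n \<Longrightarrow> poly (D (int i)) 0 *
      pochhammer (\<alpha> + 1) (n - i) * pochhammer (\<beta> + 1) (Suc i) = C * (-1) ^ i"
    using dual_bernstein_at_0[OF ab dual] by blast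
  have C': "?pa (int n - i) * ?pb (i + 1) * poly (D i) 0 = C * (-1) powi i"
    if "0 \<le> i" "i \<le> int n" for i
  proof -
    obtain k where "i = int k" using \<open>0 \<le> i\<close> by (rule nonneg_int_cases)
    moreover from this have "k \<le> n" using \<open>i \<le> int n\<close> by simp
    moreover from calculation have "nat (int n - i) = n - k" "nat (i + 1) = Suc k" by auto
    ultimately show ?thesis using C[of k] by (simp only: power_int_of_nat mult_ac)
  qed
  show thesis
  proof (rule that)
    fix i :: int assume i: "-1 \<le> i" "i \<le> int n + 1"
    let ?s = "int n - i"
    \<comment> \<open>The second difference reaches one index beyond 0 to \<open>n\<close> on either
      side; there the integer factor vanishes.\<close>
    have 1: "of_int ((i + 1) * (?s + 1)) * ?pa ?s * ?pb (i + 1) * poly (D i) 0 =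
        of_int ((i + 1) * (?s + 1)) * C * (-1) powi i"
    proof (cases "0 \<le> i \<and> i \<le> int n")
      case True
      then show ?thesis using C'[of i] by (simp add: mult.assoc)
    next
      case False
      then have "(i + 1) * (?s + 1) = 0" using i by auto
      then show ?thesis by (metis mult_zero_left of_int_0)
    qed
    \<comment> \<open>The shift to \<open>i - 1\<close> flips the sign, so this term reinforces the
      first. For \<open>i = 0\<close> and \<open>i = -1\<close> the factor
      \<open>i * (i + 1)\<close> is zero.\<close>
    have 2: "of_int (i * (i + 1)) * ?pa (?s + 1) * ?pb i * poly (D (i - 1)) 0 =
        - of_int (i * (i + 1)) * C * (-1) powi i"
    proof (cases "1 \<le> i")
      case True
      then have "?pa (?s + 1) * ?pb i * poly (D (i - 1)) 0 = C * (-1) powi (i - 1)"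
        using C'[of "i - 1"] i by (simp add: algebra_simps)
      also have "\<dots> = - C * (-1) powi i" by (simp add: power_int_diff)
      finally show ?thesis by (simp add: mult.assoc)
    next
      case False
      then have "i * (i + 1) = 0" using i by auto
      then show ?thesis by (metis mult_zero_left of_int_0 minus_zero)
    qed
    have sign: "(-1) powi ?s * (-1) powi i = (-1 :: real) ^ n"
      by (simp flip: power_int_add)
    have "poly (cleared_M \<alpha> \<beta> n D i) 0 = (-1) powi ?s *
        (of_int ((i + 1) * (?s + 1)) * ?pa ?s * ?pb (i + 1) * poly (D i) 0
         - of_int (i * (i + 1)) * ?pa (?s + 1) * ?pb i * poly (D (i - 1)) 0)"
      unfolding cleared_M_def Let_def by simp
    also have "\<dots> = ((-1) powi ?s * (-1) powi i) * C * of_int ((i + 1) * (?s + 1) + i * (i + 1))"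
      unfolding 1 2 by (simp add: algebra_simps)
    \<comment> \<open>Since \<open>i + ?s = n\<close>, the integer factor is
      \<open>(i + 1) * (n + 1)\<close>, which is affine in \<open>i\<close>.\<close>
    also have "\<dots> = (-1) ^ n * C * (real n + 1) * (of_int i + 1)"
      unfolding sign by (simp add: algebra_simps)
    finally show "poly (cleared_M \<alpha> \<beta> n D i) 0 = (-1) ^ n * C * (real n + 1) * (of_int i + 1)" .
  qed
qed

lemma cleared_M_at_1:
  assumes ab: "\<alpha> > -1" "\<beta> > -1" and dual: "dual_bernstein \<alpha> \<beta> n D"
  obtains C where "\<And>i. -1 \<le> i \<Longrightarrow> i \<le> int n + 1 \<Longrightarrow>
    poly (cleared_M \<alpha> \<beta> n D i) 1 = C * (of_int (int n - i) + 1)"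
proof -
  let ?pa = "\<lambda>l. pochhammer (\<alpha> + 1) (nat l)"
  let ?pb = "\<lambda>l. pochhammer (\<beta> + 1) (nat l)"
  obtain C where C: "\<And>i. i \<le> n \<Longrightarrow> poly (D (int i)) 1 *
      pochhammer (\<alpha> + 1) (Suc (n - i)) * pochhammer (\<beta> + 1) i = C * (-1) ^ (n - i)"
    using dual_bernstein_at_1[OF ab dual] by blast
  have C': "?pa (int n - i + 1) * ?pb i * poly (D i) 1 = C * (-1) powi (int n - i)"
    if "0 \<le> i" "i \<le> int n" for i
  proof -
    obtain k where "i = int k" using \<open>0 \<le> i\<close> by (rule nonneg_int_cases)
    moreover from this have "k \<le> n" using \<open>i \<le> int n\<close> by simp
    moreover from calculation have "nat (int n - i + 1) = Suc (n - k)" "int n - i = int (n - k)" by auto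
    ultimately show ?thesis using C[of k] by (simp only: power_int_of_nat nat_int mult_ac)
  qed
  show thesis
  proof (rule that)
    fix i :: int assume i: "-1 \<le> i" "i \<le> int n + 1"
    let ?s = "int n - i"
    have 1: "of_int ((i + 1) * (?s + 1)) * ?pa (?s + 1) * ?pb i * poly (D i) 1 =
        of_int ((i + 1) * (?s + 1)) * C * (-1) powi ?s"
    proof (cases "0 \<le> i \<and> i \<le> int n")
      case True
      then show ?thesis using C'[of i] by (simp add: mult.assoc)
    next
      case False
      then have "(i + 1) * (?s + 1) = 0" using i by auto
      then show ?thesis by (metis mult_zero_left of_int_0)
    qed
    \<comment> \<open>As at 0, with the roles of \<open>i\<close> and \<open>?s\<close> exchanged:
      the factor \<open>?s * (?s + 1)\<close> disposes of \<open>?s = 0\<close> and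
      \<open>?s = -1\<close>.\<close>
    have 2: "of_int (?s * (?s + 1)) * ?pa ?s * ?pb (i + 1) * poly (D (i + 1)) 1 =
        - of_int (?s * (?s + 1)) * C * (-1) powi ?s"
    proof (cases "i < int n")
      case True
      then have "?pa ?s * ?pb (i + 1) * poly (D (i + 1)) 1 = C * (-1) powi (?s - 1)"
        using C'[of "i + 1"] i by (simp add: algebra_simps)
      also have "\<dots> = - C * (-1) powi ?s" by (simp add: power_int_diff[of "-1" ?s 1])
      finally show ?thesis by (simp add: mult.assoc)
    next
      case False
      then have "?s * (?s + 1) = 0" using i by auto
      then show ?thesis by (metis mult_zero_left of_int_0 minus_zero)
    qed
    have sign: "(-1) powi ?s * (-1) powi ?s = (1 :: real)"
      by (simp flip: power_int_mult_distrib)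
    have "poly (cleared_M \<alpha> \<beta> n D i) 1 = (-1) powi ?s *
        (of_int ((i + 1) * (?s + 1)) * ?pa (?s + 1) * ?pb i * poly (D i) 1
         - of_int (?s * (?s + 1)) * ?pa ?s * ?pb (i + 1) * poly (D (i + 1)) 1)"
      unfolding cleared_M_def Let_def by simp
    also have "\<dots> = ((-1) powi ?s * (-1) powi ?s) * C * of_int ((i + 1) * (?s + 1) + ?s * (?s + 1))"
      unfolding 1 2 by (simp add: algebra_simps)
    also have "\<dots> = C * (real n + 1) * (of_int ?s + 1)"
      unfolding sign by (simp add: algebra_simps)
    finally show "poly (cleared_M \<alpha> \<beta> n D i) 1 = C * (real n + 1) * (of_int ?s + 1)" .
  qed
qed

lemma second_difference_cleared_M:
  assumes ab: "\<alpha> > -1" "\<beta> > -1" and dual: "dual_bernstein \<alpha> \<beta> n D" and i: "0 \<le> i" "i \<le> int n"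
  shows "cleared_M \<alpha> \<beta> n D (i + 1) - smult 2 (cleared_M \<alpha> \<beta> n D i) + cleared_M \<alpha> \<beta> n D (i - 1) = 0"
    (is "?q = 0")
proof (rule orthogonal_vanishing_endpoints_eq_0[OF ab])
  show "degree ?q \<le> n + 1"
    by (intro degree_add_le degree_diff_le order.trans[OF degree_smult_le] degree_cleared_M[OF dual])
  obtain C where "\<And>i. -1 \<le> i \<Longrightarrow> i \<le> int n + 1 \<Longrightarrow>
      poly (cleared_M \<alpha> \<beta> n D i) 0 = C * (of_int i + 1)"
    using cleared_M_at_0[OF ab dual] by blast
  then show "poly ?q 0 = 0" using i by (simp add: algebra_simps)
  obtain C where "\<And>i. -1 \<le> i \<Longrightarrow> i \<le> int n + 1 \<Longrightarrow>
      poly (cleared_M \<alpha> \<beta> n D i) 1 = C * (of_int (int n - i) + 1)"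
    using cleared_M_at_1[OF ab dual] by blast
  then show "poly ?q 1 = 0" using i by simp (simp add: algebra_simps)
  fix r :: "real poly" assume "degree r < n"
  then show "jacobi_integral \<alpha> \<beta> (?q * r) = 0"
    by (simp add: distrib_right left_diff_distrib mult_smult_left jacobi_integral_smult
        jacobi_integral_add[OF ab] jacobi_integral_diff[OF ab] cleared_M_orthogonal[OF ab dual])
qed

subsection \<open>The fourth-order operator\<close>

text \<open>For \<open>l = -1\<close> this reads c * (1 / c) = 1, the removable singularity;
  otherwise it is the recursion of the Pochhammer symbol.\<close>

lemma poch_plus_1:
  assumes "-1 \<le> l" and "l = -1 \<longrightarrow> c \<noteq> 0"
  shows "(of_int l + c + 1) * poch (c + 1) l = pochhammer (c + 1) (nat (l + 1))"
proof (cases "l = -1")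
  case True
  then show ?thesis using assms by (simp add: poch_def)
next
  case False
  then have "0 \<le> l" using assms by simp
  then show ?thesis by (simp add: poch_def nat_add_distrib pochhammer_Suc mult_ac add_ac)
qed

lemma inverse_A_coeff_mult_M_op:
  assumes i: "-1 \<le> i" "i \<le> int n + 1"
    and "i = -1 \<longrightarrow> \<beta> \<noteq> 0" and "i = int n + 1 \<longrightarrow> \<alpha> \<noteq> 0"
  shows "inverse (A_coeff \<alpha> \<beta> n i) * M_op \<alpha> \<beta> n x (\<lambda>j. poly (D j) x) i =
     K_const \<alpha> \<beta> / ((real n + 1) * pochhammer (\<alpha> + \<beta> + 2) n) * poly (cleared_M \<alpha> \<beta> n D i) x"
proof -
  define s where "s = int n - i"
  define c where "c = K_const \<alpha> \<beta> / ((real n + 1) * pochhammer (\<alpha> + \<beta> + 2) n)"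
  define pa where "pa l = pochhammer (\<alpha> + 1) (nat l)" for l
  define pb where "pb l = pochhammer (\<beta> + 1) (nat l)" for l
  have sign: "inverse ((-1) powi s) = ((-1) powi s :: real)"
    by (simp add: power_int_inverse[symmetric])
  have inv: "inverse (A_coeff \<alpha> \<beta> n i) = c * (-1) powi s * (poch (\<alpha> + 1) s * poch (\<beta> + 1) i)"
    using sign by (simp add: A_coeff_def Let_def poch_def c_def s_def divide_inverse mult_ac add_ac)
  have pa: "(of_int s + \<alpha> + 1) * poch (\<alpha> + 1) s = pa (s + 1)"
    unfolding pa_def by (rule poch_plus_1) (use assms in \<open>auto simp: s_def\<close>)
  have pb: "(of_int i + \<beta> + 1) * poch (\<beta> + 1) i = pb (i + 1)"
    unfolding pb_def by (rule poch_plus_1) (use assms in auto)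
  \<comment> \<open>At \<open>s = -1\<close> the symbol \<open>poch\<close> and its truncation
    \<open>pa\<close> may differ, but the factor \<open>s + 1\<close> is zero; likewise for
    \<open>pb'\<close>.\<close>
  have pa': "of_int (s + 1) * poch (\<alpha> + 1) s = of_int (s + 1) * pa s"
    using i by (cases "s = -1") (auto simp: pa_def poch_def s_def)
  have pb': "of_int (i + 1) * poch (\<beta> + 1) i = of_int (i + 1) * pb i"
    using i by (cases "i = -1") (auto simp: pb_def poch_def)
  have poch2: "poch t 2 = t * (t + 1)" for t
    by (simp add: poch_def eval_nat_numeral pochhammer_Suc)
  have "poch (\<alpha> + 1) s * poch (\<beta> + 1) i * M_op \<alpha> \<beta> n x (\<lambda>j. poly (D j) x) i =
      of_int i * (of_int (i + 1) * poch (\<beta> + 1) i) * ((of_int s + \<alpha> + 1) * poch (\<alpha> + 1) s) * (x - 1) * poly (D (i - 1)) x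
    - of_int s * (of_int (s + 1) * poch (\<alpha> + 1) s) * ((of_int i + \<beta> + 1) * poch (\<beta> + 1) i) * x * poly (D (i + 1)) x
    + (of_int (s + 1) * poch (\<alpha> + 1) s) * of_int (i + 1) * ((of_int i + \<beta> + 1) * poch (\<beta> + 1) i) * (1 - x) * poly (D i) x
    + (of_int (i + 1) * poch (\<beta> + 1) i) * of_int (s + 1) * ((of_int s + \<alpha> + 1) * poch (\<alpha> + 1) s) * x * poly (D i) x"
    unfolding M_op_def Let_def shift_def s_def[symmetric] poch2 by (simp add: algebra_simps)
  also have "\<dots> = 
      of_int i * (of_int (i + 1) * pb i) * pa (s + 1) * (x - 1) * poly (D (i - 1)) x
    - of_int s * (of_int (s + 1) * pa s) * pb (i + 1) * x * poly (D (i + 1)) x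
    + (of_int (s + 1) * pa s) * of_int (i + 1) * pb (i + 1) * (1 - x) * poly (D i) x
    + (of_int (i + 1) * pb i) * of_int (s + 1) * pa (s + 1) * x * poly (D i) x"
    unfolding pa pb pa' pb' ..
  finally have "inverse (A_coeff \<alpha> \<beta> n i) * M_op \<alpha> \<beta> n x (\<lambda>j. poly (D j) x) i =
      c * ((-1) powi s * (of_int i * (of_int (i + 1) * pb i) * pa (s + 1) * (x - 1) * poly (D (i - 1)) x
    - of_int s * (of_int (s + 1) * pa s) * pb (i + 1) * x * poly (D (i + 1)) x
    + (of_int (s + 1) * pa s) * of_int (i + 1) * pb (i + 1) * (1 - x) * poly (D i) x
    + (of_int (i + 1) * pb i) * of_int (s + 1) * pa (s + 1) * x * poly (D i) x))"
    unfolding inv by (simp only: mult.assoc)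
  also have "\<dots> = c * poly (cleared_M \<alpha> \<beta> n D i) x"
    unfolding cleared_M_def Let_def s_def[symmetric] pa_def[symmetric] pb_def[symmetric]
    by (simp add: algebra_simps)
  finally show ?thesis unfolding c_def .
qed

lemma N_op_eq: "N_op \<alpha> \<beta> n z i = inverse (A_coeff \<alpha> \<beta> n (i + 1)) * z (i + 1)
    - 2 * (inverse (A_coeff \<alpha> \<beta> n i) * z i) + inverse (A_coeff \<alpha> \<beta> n (i - 1)) * z (i - 1)"
  by (simp add: N_op_def fwd_diff_def shift_def numeral_2_eq_2 add.commute)

text \<open>With \<open>D\<close> arbitrary, this can be used at parameters for which
  \<open>D\<close> is not the dual family. The index \<open>i - 1\<close> is -1 only for
  \<open>i = 0\<close>, and \<open>i + 1\<close> is \<open>n + 1\<close> only for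
  \<open>i = n\<close>, whence the two conditions.\<close>

lemma N_op_M_op_eq:
  assumes i: "0 \<le> i" "i \<le> int n"
    and "i = 0 \<longrightarrow> \<beta> \<noteq> 0" and "i = int n \<longrightarrow> \<alpha> \<noteq> 0"
  shows "N_op \<alpha> \<beta> n (M_op \<alpha> \<beta> n x (\<lambda>j. poly (D j) x)) i =
     K_const \<alpha> \<beta> / ((real n + 1) * pochhammer (\<alpha> + \<beta> + 2) n) *
       poly (cleared_M \<alpha> \<beta> n D (i + 1) - smult 2 (cleared_M \<alpha> \<beta> n D i) + cleared_M \<alpha> \<beta> n D (i - 1)) x"
proof -
  define c where "c = K_const \<alpha> \<beta> / ((real n + 1) * pochhammer (\<alpha> + \<beta> + 2) n)"
  have "inverse (A_coeff \<alpha> \<beta> n k) * M_op \<alpha> \<beta> n x (\<lambda>j. poly (D j) x) k =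
      c * poly (cleared_M \<alpha> \<beta> n D k) x"
    if "k \<in> {i - 1, i, i + 1}" for k
    unfolding c_def by (rule inverse_A_coeff_mult_M_op) (use assms that in auto)
  then show ?thesis unfolding N_op_eq c_def[symmetric] by (simp add: algebra_simps)
qed

section \<open>Continuity in the parameters\<close>

lemma tendsto_pochhammer:
  fixes f :: "'a \<Rightarrow> real"
  assumes "(f \<longlongrightarrow> c) F"
  shows "((\<lambda>x. pochhammer (f x) k) \<longlongrightarrow> pochhammer c k) F"
  unfolding pochhammer_prod by (intro tendsto_intros assms)

lemma tendsto_cleared_M:
  assumes "(a \<longlongrightarrow> \<alpha>) F" and "(b \<longlongrightarrow> \<beta>) F"
  shows "((\<lambda>p. poly (cleared_M (a p) (b p) n D i) x) \<longlongrightarrow> poly (cleared_M \<alpha> \<beta> n D i) x) F"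
  unfolding cleared_M_def Let_def poly_add poly_diff poly_smult
  by (intro tendsto_intros tendsto_pochhammer assms)

lemma tendsto_K_const:
  assumes "\<alpha> > -1" and "\<beta> > -1" and "(a \<longlongrightarrow> \<alpha>) F" and "(b \<longlongrightarrow> \<beta>) F"
  shows "((\<lambda>p. K_const (a p) (b p)) \<longlongrightarrow> K_const \<alpha> \<beta>) F"
proof -
  have "\<alpha> + 1 \<notin> \<int>\<^sub>\<le>\<^sub>0" "\<beta> + 1 \<notin> \<int>\<^sub>\<le>\<^sub>0" "\<alpha> + \<beta> + 1 + 1 \<notin> \<int>\<^sub>\<le>\<^sub>0"
    using assms by (auto elim!: nonpos_Ints_cases)
  then show ?thesis
    unfolding K_const_def Let_def
    by (intro tendsto_intros tendsto_Gamma assms) (auto simp: Gamma_eq_zero_iff)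
qed

text \<open>Ensures that convergence determines \<open>Lim\<close>. The point is approached along
  the diagonal, where only two values of \<open>t\<close> meet an axis.\<close>

lemma at_within_axes_complement_neq_bot:
  "at (\<alpha>, \<beta>) within {(a, b). a \<noteq> 0 \<and> b \<noteq> 0} \<noteq> (bot :: (real \<times> real) filter)"
  unfolding trivial_limit_within islimpt_approachable not_not
proof (intro allI impI)
  fix e :: real assume "e > 0"
  then have "infinite ({0<..<e / 2} - {- \<alpha>, - \<beta>})" by (simp add: infinite_Ioo)
  then obtain t where t: "0 < t" "t < e / 2" "t \<noteq> - \<alpha>" "t \<noteq> - \<beta>"
    by (metis DiffE all_not_in_conv finite.emptyI greaterThanLessThan_iff insertCI)
  have "dist (\<alpha> + t, \<beta> + t) (\<alpha>, \<beta>) \<le> t + t"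
    using t sqrt_sum_squares_le_sum_abs[of t t] by (simp add: dist_Pair_Pair dist_real_def)
  then show "\<exists>y\<in>{(a, b). a \<noteq> 0 \<and> b \<noteq> 0}. y \<noteq> (\<alpha>, \<beta>) \<and> dist y (\<alpha>, \<beta>) < e"
    using t by (intro bexI[of _ "(\<alpha> + t, \<beta> + t)"]) auto
qed

theorem corollary5p2:
  fixes \<alpha> \<beta> x :: real and n :: nat and i :: int and D :: "int \<Rightarrow> real poly"
  assumes "\<alpha> > -1" and "\<beta> > -1"
    and "dual_bernstein \<alpha> \<beta> n D"
    and "0 \<le> i" and "i \<le> int n"
  defines "z \<equiv> (\<lambda>j. poly (D j) x)"
  shows "Q4_op \<alpha> \<beta> n x z i = 0
    \<and> ((i = 0 \<longrightarrow> \<beta> \<noteq> 0) \<and> (i = int n \<longrightarrow> \<alpha> \<noteq> 0)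
        \<longrightarrow> Q4_op \<alpha> \<beta> n x z i = N_op \<alpha> \<beta> n (M_op \<alpha> \<beta> n x z) i)"
proof -
  \<comment> \<open>\<open>V\<close> is the composition with its removable singularities cancelled;
    it tends to its value at (\<alpha>, \<beta>) even if that point lies on an axis.\<close>
  define V where "V a b = K_const a b / ((real n + 1) * pochhammer (a + b + 2) n) *
      poly (cleared_M a b n D (i + 1) - smult 2 (cleared_M a b n D i) + cleared_M a b n D (i - 1)) x" for a b
  let ?F = "at (\<alpha>, \<beta>) within {(a, b). a \<noteq> 0 \<and> b \<noteq> 0}"
  have V_eq: "N_op a b n (M_op a b n x z) i = V a b"
    if "i = 0 \<longrightarrow> b \<noteq> 0" "i = int n \<longrightarrow> a \<noteq> 0" for a b
    unfolding z_def V_def using assms that by (intro N_op_M_op_eq) auto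
  have V_0: "V \<alpha> \<beta> = 0"
    unfolding V_def second_difference_cleared_M[OF assms(1-5)] by simp
  have "pochhammer (\<alpha> + \<beta> + 2) n > 0"
    using assms by (intro pochhammer_pos) auto
  moreover have "(fst \<longlongrightarrow> \<alpha>) ?F" "(snd \<longlongrightarrow> \<beta>) ?F"
    by (auto intro!: tendsto_eq_intros)
  ultimately have "((\<lambda>p. V (fst p) (snd p)) \<longlongrightarrow> V \<alpha> \<beta>) ?F"
    unfolding V_def poly_add poly_diff poly_smult
    by (intro tendsto_intros tendsto_cleared_M tendsto_K_const tendsto_pochhammer assms) auto
  \<comment> \<open>Off the axes the composition equals \<open>V\<close> for every \<open>i\<close>,
    with \<open>z\<close> kept fixed.\<close>
  then have "((\<lambda>(a, b). N_op a b n (M_op a b n x z) i) \<longlongrightarrow> V \<alpha> \<beta>) ?F"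
    by (rule Lim_transform_eventually) (auto simp: eventually_at_filter V_eq intro!: always_eventually)
  then have "Q4_op \<alpha> \<beta> n x z i = V \<alpha> \<beta>"
    unfolding Q4_op_def by (intro tendsto_Lim at_within_axes_complement_neq_bot)
  then show ?thesis using V_0 V_eq by simp
qed

end
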